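(* Let $\kappa$ be a cardinal number with $2\leq\kappa\leq\mathbf{c}$. Then $\mathbb{R}$ can be partitioned into exactly $\kappa$ Bernstein sets all of which are homeomorphic to each other, and $\mathbb{R}$ can also be partitioned into exactly $\kappa$ Bernstein sets which are mutually non-homeomorphic.
   Context: $\mathbf{c}=2^{\aleph_0}=|\mathbb{R}|$. A set $B\subset\mathbb{R}$ is a Bernstein set if and only if neither $B$ nor $\mathbb{R}\setminus B$ contains an uncountable closed subset of $\mathbb{R}$. Subsets of $\mathbb{R}$ carry the subspace topology. *)

theory Defs
  imports "HOL-Analysis.Analysis" "HOL-Library.Disjoint_Sets"
begin

unbundle cardinal_syntax

definition bernstein :: "real set \<Rightarrow> bool" where
  "bernstein B \<longleftrightarrow>
     \<not> (\<exists>F. closed F \<and> uncountable F \<and> F \<subseteq> B) \<and>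
     \<not> (\<exists>F. closed F \<and> uncountable F \<and> F \<subseteq> UNIV - B)"

end

theory Submission
  imports Defs
begin

text \<open>
  Both partitions come from transfinite recursions of length continuum: there are only continuum many
  closed sets, and every uncountable closed set of reals has the cardinality of the continuum.

  Homeomorphic parts: choose rationally independent points so that every uncountable closed set
  contains continuum many of them. Prescribing values on these points gives an additive map
  \<open>\<phi>\<close> that maps every uncountable closed set onto the reals. Partition the target into the required
  number of translates of one set (half-open unit intervals modulo \<open>n\<close>, or a transversal of a rational
  subspace); the preimages are translates of each other and meet every uncountable closed set.

  Non-homeomorphic parts: a homeomorphism between sets of reals is determined by the closure \<open>E\<close> of its
  graph in the plane, and each point of the graph is the only point of \<open>E\<close> in its row and in its column.
  Colour the reals so that, for each closed \<open>E\<close> with continuum many such points and each colour, some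
  such point has both coordinates of that colour. Then no closed \<open>E\<close> can code a homeomorphism
  between different colour classes; taking \<open>E\<close> on the diagonal makes all classes Bernstein sets.
\<close>

section \<open>Cardinalities of closed sets\<close>

lemma card_of_closed_sets:
  "|{F :: 'a::second_countable_topology set. closed F}| \<le>o |UNIV :: real set|"
proof -
  obtain \<B> :: "'a set set" where \<B>: "countable \<B>" "topological_basis \<B>"
    using ex_countable_basis by metis
  \<comment> \<open>A closed set is determined by the basic open sets that miss it, so closed sets
    inject into the powerset of a countable base.\<close>
  define g where "g F = {b \<in> \<B>. b \<inter> F = {}}" for F
  have recover: "F = - \<Union>(g F)" if F: "closed F" for F
  proof -
    have "\<exists>b\<in>g F. x \<in> b" if x: "x \<notin> F" for x
    proof -
      obtain b where "b \<in> \<B>" "x \<in> b" "b \<subseteq> - F"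
        by (rule topological_basisE[OF \<B>(2), of "- F" x]) (use F x in auto)
      then show ?thesis unfolding g_def by blast
    qed
    then show ?thesis unfolding g_def by blast
  qed
  have "inj_on g {F. closed F}"
    by (rule inj_on_inverseI[of _ "\<lambda>S. - \<Union>S"]) (simp add: recover[symmetric])
  then have "|{F :: 'a set. closed F}| \<le>o |Pow \<B>|"
    by (rule card_of_ordLeqI) (auto simp: g_def)
  also have "|Pow \<B>| \<le>o |UNIV :: nat set set|"
    using \<B>(1) inj_on_image_Pow[OF inj_on_to_nat_on[OF \<B>(1)]] by (intro card_of_ordLeqI) auto
  also have "|UNIV :: nat set set| =o |UNIV :: real set|"
    using nat_sets_eqpoll_reals by (simp add: eqpoll_iff_card_of_ordIso)
  finally show ?thesis .
qed

text \<open>Cantor-Bendixson argument: discarding every basic open set that meets \<open>F\<close>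
  in countably many points costs only countably many points, and what remains is a nonempty perfect
  set, which contains continuum many points by completeness.\<close>

lemma card_of_closed_uncountable:
  fixes F :: "real set"
  assumes F: "closed F" "uncountable F"
  shows "|UNIV :: real set| \<le>o |F|"
proof -
  obtain \<B> :: "real set set" where \<B>: "countable \<B>" "topological_basis \<B>"
    using ex_countable_basis by metis
  define N where "N = \<Union>{b \<in> \<B>. countable (b \<inter> F)}"
  have "N \<inter> F = (\<Union>b\<in>{b \<in> \<B>. countable (b \<inter> F)}. b \<inter> F)"
    unfolding N_def by blast
  moreover have "countable (\<Union>b\<in>{b \<in> \<B>. countable (b \<inter> F)}. b \<inter> F)"
    using \<B>(1) by (intro countable_UN) auto
  ultimately have cN: "countable (N \<inter> F)" by (simp only:)
  have oN: "open N"
    unfolding N_def using topological_basis_open[OF \<B>(2)] by (intro open_Union) blast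
  define P where "P = F - N"
  \<comment> \<open>If \<open>T\<close> met \<open>P\<close> in a countable set, a basic
    neighbourhood of \<open>x\<close> inside \<open>T\<close> would meet \<open>F\<close> in a
    countable set, as \<open>N \<inter> F\<close> is countable, and so \<open>x\<close> would have
    been discarded. Hence \<open>P\<close> has no isolated point.\<close>
  have unc: "uncountable (T \<inter> P)" if T: "open T" "x \<in> T" "x \<in> P" for T x
  proof
    assume c: "countable (T \<inter> P)"
    obtain b where b: "b \<in> \<B>" "x \<in> b" "b \<subseteq> T"
      by (rule topological_basisE[OF \<B>(2) T(1,2)])
    have "b \<inter> F \<subseteq> (T \<inter> P) \<union> (N \<inter> F)"
      using b unfolding P_def by blast
    then have "countable (b \<inter> F)"
      using c cN by (meson countable_Un countable_subset)
    then have "x \<in> N" using b unfolding N_def by blast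
    with T show False unfolding P_def by blast
  qed
  have "closed P" unfolding P_def using F oN by blast
  have "\<exists>y\<in>P. y \<in> T \<and> y \<noteq> x" if "open T" "x \<in> T" "x \<in> P" for T x
  proof (rule ccontr)
    assume "\<not> ?thesis"
    then have "T \<inter> P \<subseteq> {x}" by blast
    then have "countable (T \<inter> P)" by (rule countable_subset) simp
    then show False using unc[OF that] by blast
  qed
  then have "P \<subseteq> euclidean derived_set_of P"
    by (intro subsetI) (auto simp: in_derived_set_of)
  moreover have "euclidean derived_set_of P \<subseteq> P"
    using \<open>closed P\<close> closedin_contains_derived_set[of euclidean P] by simp
  ultimately have "euclidean derived_set_of P = P" by (rule subset_antisym[rotated])
  moreover have "P \<noteq> {}"
  proof
    assume "P = {}"
    then have "F = N \<inter> F" unfolding P_def by blast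
    then show False using cN F(2) by simp
  qed
  ultimately have "(UNIV :: real set) \<lesssim> P"
    by (intro lepoll_perfect_set[OF disjI1[OF completely_metrizable_space_euclidean]])
  also have "P \<lesssim> F" unfolding P_def by (simp add: subset_imp_lepoll)
  finally show ?thesis unfolding lepoll_def card_of_ordLeq[symmetric] by blast
qed

section \<open>Enumeration by reals, transfinite recursion and fibres of colourings\<close>

lemma ex_notin_of_card_less:
  assumes "|U| <o |A|"
  shows "\<exists>x\<in>A. x \<notin> U"
  using assms by (meson card_of_mono1 not_ordLess_ordLeq subsetI)

lemma surj_from_reals:
  assumes "|A| \<le>o |UNIV :: real set|" "A \<noteq> {}"
  obtains e :: "real \<Rightarrow> 'a" where "range e = A"
proof -
  obtain e :: "real \<Rightarrow> 'a" where "e ` UNIV = A"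
    using card_of_ordLeq2[THEN iffD2, OF assms(2,1)] by auto
  then show ?thesis by (rule that)
qed

lemma card_of_Times_reals:
  assumes "|A| \<le>o |UNIV :: real set|" "|B| \<le>o |UNIV :: real set|"
  shows "|A \<times> B| \<le>o |UNIV :: real set|"
  by (rule card_of_Times_ordLeq_infinite_Field[OF _ assms card_of_Card_order])
    (unfold Field_card_of, rule infinite_UNIV_char_0)

text \<open>The recursion runs along a well-order of minimal type, in which every proper initial
  segment is smaller than the whole index type. So the set of earlier choices is always small enough
  for the hypothesis to supply the next one.\<close>

lemma transfinite_choice:
  fixes Q :: "'i \<Rightarrow> 'x \<Rightarrow> 'x set \<Rightarrow> bool"
  assumes Q: "\<And>j U. |U| <o |UNIV :: 'i set| \<Longrightarrow> \<exists>x. Q j x U"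
  obtains X :: "'i \<Rightarrow> 'x" and less :: "'i \<Rightarrow> 'i \<Rightarrow> bool"
  where "transp less" "asymp less" "totalp less" "\<And>j. Q j (X j) (X ` {i. less i j})"
proof -
  define r where "r = |UNIV :: 'i set|"
  have wo: "well_order_on UNIV r" unfolding r_def by (rule card_of_well_order_on)
  have co: "Card_order r" "Field r = UNIV"
    unfolding r_def by (rule card_of_Card_order, rule Field_card_of)
  have wf: "wf (r - Id)" using wo unfolding well_order_on_def by blast
  have lin: "trans r" "antisym r" "total r"
    using wo unfolding well_order_on_def linear_order_on_def partial_order_on_def preorder_on_def
    by auto
  define less where "less i j \<longleftrightarrow> (i, j) \<in> r - Id" for i j
  have small: "|X ` {i. less i j}| <o |UNIV :: 'i set|" for X :: "'i \<Rightarrow> 'x" and j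
  proof -
    have eq: "{i. less i j} = underS r j" unfolding underS_def less_def by auto
    have "|X ` {i. less i j}| \<le>o |underS r j|" unfolding eq by (rule card_of_image)
    also have "|underS r j| <o r" using card_of_underS[OF co(1)] co(2) by simp
    finally show ?thesis by (simp only: r_def)
  qed
  have "\<exists>X. \<forall>j. Q j (X j) (X ` {i. less i j})"
  \<comment> \<open>The predicate sees the function only through its values at earlier indices, as
    well-founded choice demands.\<close>
  proof (rule dependent_wf_choice[OF wf, where P = "\<lambda>X j x. Q j x (X ` {i. less i j})"])
    fix f g :: "'i \<Rightarrow> 'x" and j x
    assume "\<And>z. (z, j) \<in> r - Id \<Longrightarrow> f z = g z"
    then have "f ` {i. less i j} = g ` {i. less i j}"
      unfolding less_def by (intro image_cong) auto
    then show "Q j x (f ` {i. less i j}) = Q j x (g ` {i. less i j})" by simp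
  next
    fix j and f :: "'i \<Rightarrow> 'x"
    show "\<exists>x. Q j x (f ` {i. less i j})" by (rule Q[OF small])
  qed
  moreover have "transp less" unfolding less_def
    using lin by (intro transpI) (metis DiffD1 DiffD2 DiffI IdI antisymD pair_in_Id_conv transD)
  moreover have "asymp less" unfolding less_def
    using lin by (intro asympI) (auto dest: antisymD)
  moreover have "totalp less" unfolding less_def
    using lin by (intro totalpI) (auto simp: total_on_def)
  ultimately show ?thesis using that by blast
qed

text \<open>An uncountable closed set cannot lie inside the fibre of \<open>k\<close>, since it also
  takes another value \<open>l\<close>, nor outside it, since it takes the value \<open>k\<close>.
  Applied to the whole line, the hypothesis makes all fibres nonempty, so distinct colours give
  distinct parts.\<close>

lemma bernstein_fibres:
  fixes f :: "real \<Rightarrow> 'a"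
  assumes K: "range f \<subseteq> K" "a \<in> K" "b \<in> K" "a \<noteq> b"
    and f: "\<And>F k. closed F \<Longrightarrow> uncountable F \<Longrightarrow> k \<in> K \<Longrightarrow> \<exists>x\<in>F. f x = k"
  defines "P \<equiv> (\<lambda>k. f -` {k}) ` K"
  shows "partition_on UNIV P" "|P| =o |K|" "\<And>B. B \<in> P \<Longrightarrow> bernstein B"
proof -
  have ne: "\<exists>x. f x = k" if "k \<in> K" for k
    using f[of UNIV k] that uncountable_UNIV_real by auto
  show "partition_on UNIV P"
    unfolding partition_on_def P_def disjoint_def using K(1) ne by fastforce
  have "inj_on (\<lambda>k. f -` {k}) K"
    using ne by (intro inj_onI) blast
  then show "|P| =o |K|"
    unfolding P_def by (meson bij_betw_imageI card_of_ordIsoI ordIso_symmetric)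
  fix B assume "B \<in> P"
  then obtain k where k: "k \<in> K" "B = f -` {k}" unfolding P_def by blast
  obtain l where l: "l \<in> K" "l \<noteq> k" using K by metis
  show "bernstein B"
    unfolding bernstein_def k(2) using f k(1) l by blast
qed

section \<open>The reals as a rational vector space\<close>

interpretation rat_real: vector_space_pair 
    "\<lambda>(q::rat) (x::real). of_rat q * x" "\<lambda>(q::rat) (x::real). of_rat q * x"
  by unfold_locales (auto simp: algebra_simps of_rat_add of_rat_mult)

text \<open>The span is exhausted by countably many stages, each the image of a product of earlier
  stages with the rationals; an infinite cardinal absorbs such products and countable
  unions.\<close>

lemma card_of_rat_span:
  fixes A :: "real set"
  assumes A: "infinite A"
  shows "|rat_real.vs1.span A| \<le>o |A|"
proof -
  define T where "T = rec_nat A (\<lambda>_ S. (\<lambda>(x, y, q::rat). x + of_rat q * y) ` (S \<times> S \<times> UNIV))"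
  have T0: "T 0 = A" and TS: "T (Suc n) = (\<lambda>(x, y, q::rat). x + of_rat q * y) ` (T n \<times> T n \<times> UNIV)" for n
    by (simp_all add: T_def)
  have cnt: "|C| \<le>o |A|" if "countable C" for C :: "'b set"
  proof -
    have "|C| \<le>o |UNIV :: nat set|" using that unfolding countable_def card_of_ordLeq[symmetric] by auto
    also have "|UNIV :: nat set| \<le>o |A|" using A infinite_iff_card_of_nat by blast
    finally show ?thesis .
  qed
  have prod: "|C \<times> D| \<le>o |A|" if "|C| \<le>o |A|" "|D| \<le>o |A|" for C :: "'b set" and D :: "'c set"
    by (rule card_of_Times_ordLeq_infinite_Field[OF _ that card_of_Card_order])
      (simp add: Field_card_of A)
  have "|T n| \<le>o |A|" for n
  proof (induction n)
    case 0 show ?case unfolding T0 by (rule card_of_mono1) simp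
  next
    case (Suc n)
    have "|T n \<times> T n \<times> (UNIV :: rat set)| \<le>o |A|"
      by (rule prod[OF Suc prod[OF Suc cnt]]) simp
    then show ?case unfolding TS by (rule ordLeq_transitive[OF card_of_image])
  qed
  then have U: "|\<Union>n. T n| \<le>o |A|"
    by (intro card_of_UNION_ordLeq_infinite[OF A cnt]) blast+
  have step: "x + of_rat q * y \<in> T (Suc n)" if "x \<in> T n" "y \<in> T n" for x y q n
    unfolding TS using that by force
  have mono: "T m \<subseteq> T n" if "m \<le> n" for m n
    using that
  proof (rule lift_Suc_mono_le[rotated])
    fix n show "T n \<le> T (Suc n)" using step[of _ n _ 0] by auto
  qed
  \<comment> \<open>The single operation \<open>x + q * y\<close> yields everything: zero is
    \<open>a + (-1) * a\<close>, sums use \<open>q = 1\<close>, and \<open>c * x\<close> is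
    \<open>x + (c - 1) * x\<close>.\<close>
  have "rat_real.vs1.subspace (\<Union>n. T n)"
  proof (rule rat_real.vs1.subspaceI)
    obtain a where "a \<in> A" using A by fastforce
    then have "a + of_rat (-1) * a \<in> T 1" using step[of a 0 a "-1"] by (simp add: T0)
    then show "0 \<in> (\<Union>n. T n)" by (auto simp: of_rat_minus)
  next
    fix x y assume "x \<in> (\<Union>n. T n)" "y \<in> (\<Union>n. T n)"
    then obtain m n where "x \<in> T m" "y \<in> T n" by blast
    then have "x \<in> T (max m n)" "y \<in> T (max m n)" 
      using mono[of m "max m n"] mono[of n "max m n"] by auto
    then show "x + y \<in> (\<Union>n. T n)" using step[of x "max m n" y 1] by auto
  next
    fix c :: rat and x assume "x \<in> (\<Union>n. T n)"
    then obtain n where "x \<in> T n" by blast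
    then have "x + of_rat (c - 1) * x \<in> T (Suc n)" by (intro step)
    then have "of_rat c * x \<in> T (Suc n)" by (simp add: of_rat_diff algebra_simps)
    then show "of_rat c * x \<in> (\<Union>n. T n)" by blast
  qed
  then have "rat_real.vs1.span A \<subseteq> (\<Union>n. T n)"
    using T0 by (intro rat_real.vs1.span_minimal) auto
  then show ?thesis by (rule ordLeq_transitive[OF card_of_mono1 U])
qed

text \<open>Adjoining the naturals brings a finite \<open>A\<close> under the bound for infinite
  sets; by Cantor's theorem the enlarged set is still smaller than the continuum.\<close>

lemma card_of_rat_span_less:
  fixes A :: "real set"
  assumes A: "|A| <o |UNIV :: real set|"
  shows "|rat_real.vs1.span A| <o |UNIV :: real set|"
proof -
  have "|range real| \<le>o |UNIV :: nat set|"
    by (rule card_of_image)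
  also have "|UNIV :: nat set| <o |UNIV :: nat set set|"
    using card_of_Pow[of "UNIV :: nat set"] by simp
  also have "|UNIV :: nat set set| =o |UNIV :: real set|"
    using nat_sets_eqpoll_reals by (simp add: eqpoll_iff_card_of_ordIso)
  finally have "|range real| <o |UNIV :: real set|" .
  then have less: "|A \<union> range real| <o |UNIV :: real set|"
    using A by (intro card_of_Un_ordLess_infinite) (auto simp: infinite_UNIV_char_0)
  have "infinite (A \<union> range real)"
    using range_inj_infinite[of real] by (simp add: inj_def)
  then have "|rat_real.vs1.span (A \<union> range real)| <o |UNIV :: real set|"
    using card_of_rat_span less by (metis ordLeq_ordLess_trans)
  moreover have "rat_real.vs1.span A \<subseteq> rat_real.vs1.span (A \<union> range real)"
    by (intro rat_real.vs1.span_mono) auto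
  ultimately show ?thesis by (metis card_of_mono1 ordLeq_ordLess_trans)
qed

text \<open>A pair \<open>(F, y)\<close> is the demand that some point of \<open>F\<close> be sent
  to \<open>y\<close>. Each demand gets its own point, and rational independence of these points
  lets one linear map meet all demands.\<close>

lemma additive_onto_on_closed_uncountable:
  obtains \<phi> :: "real \<Rightarrow> real"
  where "\<And>x y. \<phi> (x + y) = \<phi> x + \<phi> y" "\<And>F. closed F \<Longrightarrow> uncountable F \<Longrightarrow> \<phi> ` F = UNIV"
proof -
  define \<F> where "\<F> = {F :: real set. closed F \<and> uncountable F}"
  have "|\<F>| \<le>o |UNIV :: real set|"
    unfolding \<F>_def by (rule ordLeq_transitive[OF card_of_mono1 card_of_closed_sets]) auto
  then have "|\<F> \<times> (UNIV :: real set)| \<le>o |UNIV :: real set|"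
    by (rule card_of_Times_reals) (rule card_of_mono1[OF subset_UNIV])
  moreover have "UNIV \<in> \<F>" unfolding \<F>_def using uncountable_UNIV_real by auto
  ultimately obtain e :: "real \<Rightarrow> real set \<times> real" where e: "range e = \<F> \<times> UNIV"
    using surj_from_reals[of "\<F> \<times> (UNIV :: real set)"] by blast
  \<comment> \<open>Fewer than continuum many reals span a set too small to cover an uncountable
    closed set.\<close>
  have ex: "\<exists>x. x \<in> fst (e j) \<and> x \<notin> rat_real.vs1.span U" if "|U| <o |UNIV :: real set|" for j U
  proof -
    have "fst (e j) \<in> \<F>" using e by (metis mem_Sigma_iff prod.collapse rangeI)
    then have "|UNIV :: real set| \<le>o |fst (e j)|"
      unfolding \<F>_def by (intro card_of_closed_uncountable) auto
    with card_of_rat_span_less[OF that] have "|rat_real.vs1.span U| <o |fst (e j)|"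
      by (rule ordLess_ordLeq_trans)
    then show ?thesis using ex_notin_of_card_less[of "rat_real.vs1.span U" "fst (e j)"] by blast
  qed
  obtain X :: "real \<Rightarrow> real" and less where less: "transp less" "asymp less" "totalp less"
    and X: "\<And>j. X j \<in> fst (e j) \<and> X j \<notin> rat_real.vs1.span (X ` {i. less i j})"
    by (rule transfinite_choice[where Q = "\<lambda>j x U. x \<in> fst (e j) \<and> x \<notin> rat_real.vs1.span U", OF ex])
      (assumption, rule that)
  \<comment> \<open>Among finitely many indices the latest one, \<open>m\<close>, has all others
    before it, so \<open>X m\<close> lies outside their span and can be added back without losing
    independence.\<close>
  have fin: "rat_real.vs1.independent (X ` I)" if "finite I" for I
    using that
  proof (induction I rule: finite_remove_induct)
    case empty then show ?case by (simp add: rat_real.vs1.independent_empty)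
  next
    case (remove I)
    obtain m where m: "m \<in> I" "\<And>x. x \<in> I \<Longrightarrow> x \<noteq> m \<Longrightarrow> \<not> less m x"
      using Finite_Set.bex_max_element[OF remove(1) _ _ remove(2), of less]
        asymp_on_subset[OF less(2) subset_UNIV] transp_on_subset[OF less(1) subset_UNIV] by blast
    then have "I - {m} \<subseteq> {i. less i m}" using less(3) by (auto dest: totalpD)
    then have "X m \<notin> rat_real.vs1.span (X ` (I - {m}))"
      using X rat_real.vs1.span_mono[OF image_mono] by blast
    then have "rat_real.vs1.independent (insert (X m) (X ` (I - {m})))"
      using remove.IH[OF m(1)] by (simp add: rat_real.vs1.independent_insertI)
    then show ?case using m(1) by (metis image_insert insert_Diff)
  qed
  have ind: "rat_real.vs1.independent (range X)"
  proof
    assume "rat_real.vs1.dependent (range X)"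
    then obtain t u where t: "finite t" "t \<subseteq> range X" "(\<Sum>v\<in>t. of_rat (u v) * v) = 0" "\<exists>v\<in>t. u v \<noteq> 0"
      unfolding rat_real.vs1.dependent_explicit by blast
    then obtain I where "finite I" "t = X ` I" by (meson finite_subset_image)
    then have "rat_real.vs1.independent t" using fin by simp
    then show False using t unfolding rat_real.vs1.dependent_explicit by blast
  qed
  \<comment> \<open>Injectivity lets \<open>inv X\<close> recover the stage, hence the prescribed
    value, from the chosen point.\<close>
  have "inj X"
  proof (rule injI, rule ccontr)
    fix i j assume ij: "X i = X j" "i \<noteq> j"
    have "X i \<noteq> X j" if "less i j" for i j
      using X[of j] rat_real.vs1.span_base[of "X i" "X ` {i. less i j}"] that by auto
    then show False using ij less(3) by (metis totalpD)
  qed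
  obtain \<phi> where lin: "Vector_Spaces.linear (\<lambda>(q::rat) (x::real). of_rat q * x) (\<lambda>(q::rat) (x::real). of_rat q * x) \<phi>"
    and \<phi>: "\<And>x. x \<in> range X \<Longrightarrow> \<phi> x = snd (e (inv X x))"
    using rat_real.linear_independent_extend[OF ind, of "\<lambda>x. snd (e (inv X x))"] by blast
  show ?thesis
  proof
    show "\<phi> (x + y) = \<phi> x + \<phi> y" for x y
      using lin by (rule rat_real.linear_add)
  next
    fix F :: "real set" assume "closed F" "uncountable F"
    then have "F \<in> \<F>" unfolding \<F>_def by blast
    have "y \<in> \<phi> ` F" for y
    proof -
      have "(F, y) \<in> range e" unfolding e using \<open>F \<in> \<F>\<close> by blast
      then obtain j where j: "e j = (F, y)" by force
      have "\<phi> (X j) = y" using \<phi> \<open>inj X\<close> j by (simp add: inv_f_f)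
      moreover have "X j \<in> F" using X[of j] j by simp
      ultimately show ?thesis by blast
    qed
    then show "\<phi> ` F = UNIV" by blast
  qed
qed

section \<open>Homeomorphic parts from tilings of the line by translates\<close>

lemma partition_into_translates:
  fixes K :: "real set"
  assumes "K \<noteq> {}"
  obtains S T :: "real set" where "|S| =o |K|" "\<And>x. \<exists>!s. s \<in> S \<and> x - s \<in> T"
proof (cases "finite K")
  case True
  define n where "n = int (card K)"
  have n: "n > 0" using True assms unfolding n_def by (simp add: card_gt_0_iff)
  \<comment> \<open>The tile \<open>T\<close> is the union of the intervals
    \<open>[m * n, m * n + 1)\<close> over integers \<open>m\<close>; the shift belonging to
    \<open>x\<close> is the residue of its floor modulo \<open>n\<close>.\<close>
  define S where "S = real_of_int ` {0..<n}"
  define T where "T = {x :: real. \<lfloor>x\<rfloor> mod n = 0}"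
  have "card S = card K"
    unfolding S_def n_def by (subst card_image) (auto simp: inj_on_def)
  then have "|S| =o |K|"
    using True unfolding S_def by (metis card_of_ordIso finite_atLeastLessThan_int finite_imageI finite_same_card_bij)
  moreover have "\<exists>!s. s \<in> S \<and> x - s \<in> T" for x
  proof (rule ex1I)
    have "(\<lfloor>x\<rfloor> - \<lfloor>x\<rfloor> mod n) mod n = 0" by (simp add: mod_diff_right_eq)
    moreover have "\<lfloor>x - real_of_int (\<lfloor>x\<rfloor> mod n)\<rfloor> = \<lfloor>x\<rfloor> - \<lfloor>x\<rfloor> mod n"
      by (rule floor_diff_of_int)
    ultimately show "real_of_int (\<lfloor>x\<rfloor> mod n) \<in> S \<and> x - real_of_int (\<lfloor>x\<rfloor> mod n) \<in> T"
      unfolding S_def T_def using n by simp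
  next
    fix s assume s: "s \<in> S \<and> x - s \<in> T"
    then obtain i where i: "s = real_of_int i" "0 \<le> i" "i < n" unfolding S_def by auto
    then have "(\<lfloor>x\<rfloor> - i) mod n = 0" using s unfolding T_def by simp
    then have "\<lfloor>x\<rfloor> mod n = i mod n" by (simp add: mod_eq_dvd_iff dvd_eq_mod_eq_0)
    then show "s = real_of_int (\<lfloor>x\<rfloor> mod n)" using i by simp
  qed
  ultimately show ?thesis using that by blast
next
  case False
  \<comment> \<open>\<open>S\<close> is a subgroup of the size of \<open>K\<close>, and the tile is
    the transversal of its cosets picked by \<open>rep\<close>; the shift belonging to
    \<open>x\<close> is \<open>x - rep x\<close>.\<close>
  define S where "S = rat_real.vs1.span K"
  have sub: "0 \<in> S" "\<And>x y. x \<in> S \<Longrightarrow> y \<in> S \<Longrightarrow> x + y \<in> S" "\<And>x y. x \<in> S \<Longrightarrow> y \<in> S \<Longrightarrow> x - y \<in> S"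
    unfolding S_def by (auto intro: rat_real.vs1.span_zero rat_real.vs1.span_add rat_real.vs1.span_diff)
  have "|K| \<le>o |S|" unfolding S_def using rat_real.vs1.span_superset by (rule card_of_mono1)
  then have card: "|S| =o |K|"
    using card_of_rat_span[OF False] by (metis S_def ordIso_iff_ordLeq)
  define rep where "rep x = (SOME y. x - y \<in> S)" for x
  have rep: "x - rep x \<in> S" for x
    unfolding rep_def using sub(1) someI[of "\<lambda>y. x - y \<in> S" x] by simp
  have rep_eq: "rep x = rep y" if "x - y \<in> S" for x y
  proof -
    have "x - z \<in> S \<longleftrightarrow> y - z \<in> S" for z
      using sub(2)[OF that, of "y - z"] sub(3)[OF _ that, of "x - z"] by auto
    then show ?thesis unfolding rep_def by simp
  qed
  have "\<exists>!s. s \<in> S \<and> x - s \<in> range rep" for x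
  proof (rule ex1I)
    show "x - rep x \<in> S \<and> x - (x - rep x) \<in> range rep" using rep by simp
  next
    fix s assume s: "s \<in> S \<and> x - s \<in> range rep"
    then obtain z where z: "x - s = rep z" by blast
    have "z - (x - s) \<in> S" using rep[of z] z by simp
    then have "rep z = rep (x - s)" by (rule rep_eq)
    also have "\<dots> = rep x" using rep_eq[of x "x - s"] s by simp
    finally show "s = x - rep x" using z by simp
  qed
  with card show ?thesis using that by blast
qed

lemma homeomorphic_bernstein_partition:
  fixes K :: "real set"
  assumes K: "a \<in> K" "b \<in> K" "a \<noteq> b"
  obtains P where "partition_on UNIV P" "|P| =o |K|" "\<And>B. B \<in> P \<Longrightarrow> bernstein B"
    "\<And>A B. A \<in> P \<Longrightarrow> B \<in> P \<Longrightarrow> A homeomorphic B"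
proof -
  have ne: "K \<noteq> {}" using K(1) by blast
  obtain S T :: "real set" where card: "|S| =o |K|" and ST: "\<And>x. \<exists>!s. s \<in> S \<and> x - s \<in> T"
    by (rule partition_into_translates[OF ne]) (rule that)
  obtain \<phi> :: "real \<Rightarrow> real" where add: "\<And>x y. \<phi> (x + y) = \<phi> x + \<phi> y"
    and onto: "\<And>F. closed F \<Longrightarrow> uncountable F \<Longrightarrow> \<phi> ` F = UNIV"
    by (rule additive_onto_on_closed_uncountable) (rule that)
  \<comment> \<open>The colour of \<open>x\<close> is the shift of the tile that contains
    \<open>\<phi> x\<close>.\<close>
  define f where "f x = (THE s. s \<in> S \<and> \<phi> x - s \<in> T)" for x
  have f: "f x \<in> S \<and> \<phi> x - f x \<in> T" for x
    unfolding f_def by (rule theI'[OF ST])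
  have f_eq: "f x = s" if "s \<in> S" "\<phi> x - s \<in> T" for x s
    using f ST that by blast
  obtain t where t: "t \<in> T" using f by blast
  obtain g where g: "bij_betw g K S"
    using card card_of_ordIso ordIso_symmetric by blast
  have ab: "g a \<in> S" "g b \<in> S" "g a \<noteq> g b"
    using g K by (auto simp: bij_betw_def inj_on_def)
  have hit: "\<exists>x\<in>F. f x = k" if F: "closed F" "uncountable F" and k: "k \<in> S" for F k
  proof -
    obtain x where "x \<in> F" "\<phi> x = t + k"
      using onto[OF F] by (metis UNIV_I imageE)
    then show ?thesis using f_eq[of k x] t k by auto
  qed
  define P where "P = (\<lambda>k. f -` {k}) ` S"
  have rng: "range f \<subseteq> S" using f by blast
  note fib = bernstein_fibres[OF rng ab hit, folded P_def]
  show ?thesis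
  proof
    show "partition_on UNIV P" "\<And>B. B \<in> P \<Longrightarrow> bernstein B" using fib by blast+
    show "|P| =o |K|" using fib(2) card by (rule ordIso_transitive)
    fix A B assume "A \<in> P" "B \<in> P"
    then obtain k l where kl: "k \<in> S" "l \<in> S" "A = f -` {k}" "B = f -` {l}"
      unfolding P_def by blast
    \<comment> \<open>By additivity, translation by \<open>d\<close> moves \<open>\<phi>\<close> by
      \<open>l - k\<close> and thus carries the tile shifted by \<open>k\<close> to the one shifted
      by \<open>l\<close>; on the line it carries \<open>A\<close> onto \<open>B\<close>.\<close>
    obtain d where d: "\<phi> d = l - k"
      using onto[of UNIV] uncountable_UNIV_real by (metis UNIV_I closed_UNIV imageE)
    have shift: "f (d + x) = l \<longleftrightarrow> f x = k" for x
    proof -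
      have "\<phi> (d + x) - l = \<phi> x - k" using add d by simp
      then show ?thesis using f[of x] f[of "d + x"] f_eq kl(1,2) by metis
    qed
    have "B = (+) d ` A"
    proof
      show "(+) d ` A \<subseteq> B" unfolding kl using shift by auto
      show "B \<subseteq> (+) d ` A"
      proof
        fix y assume "y \<in> B"
        then have "y - d \<in> A" unfolding kl using shift[of "y - d"] by simp
        then show "y \<in> (+) d ` A" by (intro image_eqI[of _ _ "y - d"]) auto
      qed
    qed
    then show "A homeomorphic B" using homeomorphic_translation[of A d] by simp
  qed
qed

section \<open>Non-homeomorphic parts from closed sets coding homeomorphisms\<close>

definition biunique_part :: "('a \<times> 'b) set \<Rightarrow> ('a \<times> 'b) set" where
  "biunique_part E = {(x, y) \<in> E. (\<forall>y'. (x, y') \<in> E \<longrightarrow> y' = y) \<and> (\<forall>x'. (x', y) \<in> E \<longrightarrow> x' = x)}"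

lemma biunique_partD:
  assumes "(x, y) \<in> biunique_part E"
  shows "(x, y) \<in> E" "(x, y') \<in> E \<Longrightarrow> y' = y" "(x', y) \<in> E \<Longrightarrow> x' = x"
  using assms unfolding biunique_part_def by blast+

lemma inj_on_fst_biunique_part: "inj_on fst (biunique_part E)"
proof (rule inj_onI)
  fix p q assume "p \<in> biunique_part E" "q \<in> biunique_part E" "fst p = fst q"
  then show "p = q" by (cases p; cases q) (auto dest: biunique_partD(1,2))
qed

lemma inj_on_snd_biunique_part: "inj_on snd (biunique_part E)"
proof (rule inj_onI)
  fix p q assume "p \<in> biunique_part E" "q \<in> biunique_part E" "snd p = snd q"
  then show "p = q" by (cases p; cases q) (auto dest: biunique_partD(1,3))
qed

text \<open>A sequence in the graph tending to \<open>(x, y')\<close> forces \<open>y' = h x\<close>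
  by continuity of \<open>h\<close>; one tending to \<open>(x', h x)\<close> forces
  \<open>x' = x\<close> by continuity of the inverse \<open>g\<close>. Homeomorphisms are thereby
  coded by closed sets, few enough to enumerate.\<close>

lemma closure_homeomorphism_graph:
  fixes h :: "'a::metric_space \<Rightarrow> 'b::metric_space"
  assumes hom: "homeomorphism A B h g" and x: "x \<in> A"
  shows "(x, h x) \<in> biunique_part (closure ((\<lambda>x. (x, h x)) ` A))"
proof -
  let ?G = "(\<lambda>x. (x, h x)) ` A"
  have hg: "continuous_on A h" "continuous_on B g" "\<And>x. x \<in> A \<Longrightarrow> g (h x) = x"
    by (rule homeomorphism_cont1[OF hom] homeomorphism_cont2[OF hom] homeomorphism_apply1[OF hom], assumption?)+
  have hB: "h x \<in> B" if "x \<in> A" for x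
    using imageI[OF that, of h] homeomorphism_image1[OF hom] by simp
  have seq: "\<exists>u. (\<forall>n. u n \<in> A) \<and> u \<longlonglongrightarrow> x' \<and> (\<lambda>n. h (u n)) \<longlonglongrightarrow> y'"
    if clos: "(x', y') \<in> closure ?G" for x' y'
  proof -
    obtain p where p: "\<And>n. p n \<in> ?G" "p \<longlonglongrightarrow> (x', y')"
      using closure_sequential[THEN iffD1, OF clos] by metis
    define u where "u n = fst (p n)" for n
    have u: "u n \<in> A \<and> snd (p n) = h (u n)" for n using p(1)[of n] unfolding u_def by auto
    have "u \<longlonglongrightarrow> x'" using tendsto_fst[OF p(2)] unfolding u_def by simp
    moreover have "(\<lambda>n. h (u n)) \<longlonglongrightarrow> y'" using tendsto_snd[OF p(2)] u by simp
    ultimately show ?thesis using u by blast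
  qed
  have "(x, h x) \<in> closure ?G" using x closure_subset by fastforce
  moreover have "y' = h x" if y': "(x, y') \<in> closure ?G" for y'
  proof -
    obtain u where u: "\<And>n. u n \<in> A" "u \<longlonglongrightarrow> x" "(\<lambda>n. h (u n)) \<longlonglongrightarrow> y'"
      using seq[OF y'] by blast
    have "(\<lambda>n. h (u n)) \<longlonglongrightarrow> h x"
      using continuous_on_tendsto_compose[OF hg(1) u(2) x] u(1) by simp
    then show ?thesis using u(3) LIMSEQ_unique by blast
  qed
  moreover have "x' = x" if x': "(x', h x) \<in> closure ?G" for x'
  proof -
    obtain u where u: "\<And>n. u n \<in> A" "u \<longlonglongrightarrow> x'" "(\<lambda>n. h (u n)) \<longlonglongrightarrow> h x"
      using seq[OF x'] by blast
    have "(\<lambda>n. g (h (u n))) \<longlonglongrightarrow> g (h x)"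
      using continuous_on_tendsto_compose[OF hg(2) u(3)] hB x u(1) by simp
    then have "u \<longlonglongrightarrow> x" using hg(3) x u(1) by simp
    then show ?thesis using u(2) LIMSEQ_unique by blast
  qed
  ultimately show ?thesis unfolding biunique_part_def by blast
qed

lemma colouring_of_biunique_parts:
  fixes K :: "real set"
  assumes "K \<noteq> {}"
  obtains f :: "real \<Rightarrow> real" where "range f \<subseteq> K"
    "\<And>E k. closed E \<Longrightarrow> |UNIV :: real set| \<le>o |biunique_part E| \<Longrightarrow> k \<in> K
      \<Longrightarrow> |UNIV :: real set| \<le>o |{x. f x = k \<and> (\<exists>y. (x, y) \<in> biunique_part E \<and> f y = k)}|"
proof -
  define \<E> where "\<E> = {E :: (real \<times> real) set. closed E \<and> |UNIV :: real set| \<le>o |biunique_part E|}"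
  obtain k0 where k0: "k0 \<in> K" using assms by blast
  show ?thesis
  proof (cases "\<E> = {}")
    case True
    show ?thesis
      by (rule that[of "\<lambda>_. k0"]) (use True k0 in \<open>auto simp: \<E>_def\<close>)
  next
    case False
    have "|\<E>| \<le>o |UNIV :: real set|"
      unfolding \<E>_def by (rule ordLeq_transitive[OF card_of_mono1 card_of_closed_sets]) auto
    then have "|\<E> \<times> K \<times> (UNIV :: real set)| \<le>o |UNIV :: real set|"
      by (intro card_of_Times_reals card_of_mono1[OF subset_UNIV])
    moreover have "\<E> \<times> K \<times> (UNIV :: real set) \<noteq> {}" using False k0 by blast
    \<comment> \<open>The third component makes every closed set and colour recur continuum many times.\<close>
    ultimately obtain e :: "real \<Rightarrow> (real \<times> real) set \<times> real \<times> real" where e: "range e = \<E> \<times> K \<times> UNIV"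
      using surj_from_reals by blast
    define E where "E j = fst (e j)" for j
    define c where "c j = fst (snd (e j))" for j
    have Ec: "E j \<in> \<E>" "c j \<in> K" for j
      using rangeI[of e j] unfolding e E_def c_def by auto
    have ex: "\<exists>p. p \<in> biunique_part (E j) \<and> fst p \<notin> fst ` U \<union> snd ` U \<and> snd p \<notin> fst ` U \<union> snd ` U"
      if U: "|U| <o |UNIV :: real set|" for j and U :: "(real \<times> real) set"
    proof -
      \<comment> \<open>\<open>W\<close> holds the coordinates already used. Each of them spoils at
        most one point through its column (\<open>V1\<close>) and one through its row
        (\<open>V2\<close>), so fewer than continuum many points are excluded.\<close>
      define W where "W = fst ` U \<union> snd ` U"
      have W: "|W| <o |UNIV :: real set|" unfolding W_def
        by (rule card_of_Un_ordLess_infinite[OF infinite_UNIV_char_0];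
            rule ordLeq_ordLess_trans[OF card_of_image U])
      define V1 where "V1 = {p \<in> biunique_part (E j). fst p \<in> W}"
      define V2 where "V2 = {p \<in> biunique_part (E j). snd p \<in> W}"
      have "|V1| \<le>o |W|" unfolding V1_def
        by (rule card_of_ordLeqI[OF inj_on_subset[OF inj_on_fst_biunique_part]]) auto
      moreover have "|V2| \<le>o |W|" unfolding V2_def
        by (rule card_of_ordLeqI[OF inj_on_subset[OF inj_on_snd_biunique_part]]) auto
      ultimately have "|V1 \<union> V2| <o |UNIV :: real set|"
        using W by (intro card_of_Un_ordLess_infinite[OF infinite_UNIV_char_0])
          (erule (1) ordLeq_ordLess_trans)+
      moreover have "|UNIV :: real set| \<le>o |biunique_part (E j)|"
        using Ec(1)[of j] unfolding \<E>_def by blast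
      ultimately have "|V1 \<union> V2| <o |biunique_part (E j)|"
        by (rule ordLess_ordLeq_trans)
      then show ?thesis
        using ex_notin_of_card_less[of "V1 \<union> V2"] unfolding V1_def V2_def W_def[symmetric] by blast
    qed
    obtain X :: "real \<Rightarrow> real \<times> real" and less where less: "totalp less"
      and X: "\<And>j. X j \<in> biunique_part (E j) \<and>
        fst (X j) \<notin> fst ` X ` {i. less i j} \<union> snd ` X ` {i. less i j} \<and>
        snd (X j) \<notin> fst ` X ` {i. less i j} \<union> snd ` X ` {i. less i j}"
      by (rule transfinite_choice[where Q = "\<lambda>j p U. p \<in> biunique_part (E j) \<and>
        fst p \<notin> fst ` U \<union> snd ` U \<and> snd p \<notin> fst ` U \<union> snd ` U", OF ex])
        (assumption, rule that)
    \<comment> \<open>Different stages never share a coordinate, so no real receives two colours;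
      within one stage the two coordinates may coincide.\<close>
    have disj: "{fst (X i), snd (X i)} \<inter> {fst (X j), snd (X j)} = {}" if "less i j" for i j
      using X[of j] that by (force simp: image_iff)
    have uniq: "i = j" if "x \<in> {fst (X i), snd (X i)}" "x \<in> {fst (X j), snd (X j)}" for i j x
    proof (rule ccontr)
      assume "i \<noteq> j"
      then have "less i j \<or> less j i" using less by (auto dest: totalpD)
      then show False using disj that by blast
    qed
    \<comment> \<open>Reals never chosen at any stage get the default colour
      \<open>k0\<close>.\<close>
    define f where "f x = (if \<exists>j. x \<in> {fst (X j), snd (X j)}
      then c (THE j. x \<in> {fst (X j), snd (X j)}) else k0)" for x
    have f: "f x = c j" if "x \<in> {fst (X j), snd (X j)}" for x j
    proof -
      have "(THE j. x \<in> {fst (X j), snd (X j)}) = j"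
        using uniq that by (intro the_equality) blast+
      then show ?thesis unfolding f_def using that by metis
    qed
    show ?thesis
    proof
      show "range f \<subseteq> K" unfolding f_def using Ec(2) k0 by auto
    next
      fix D :: "(real \<times> real) set" and k
      assume D: "closed D" "|UNIV :: real set| \<le>o |biunique_part D|" and k: "k \<in> K"
      then have "D \<in> \<E>" unfolding \<E>_def by blast
      then have "\<exists>j. e j = (D, k, r)" for r
        using k e by (metis (no_types, lifting) SigmaI UNIV_I imageE)
      \<comment> \<open>The stages \<open>j r\<close> all treat the same set and colour; their
        points have distinct first coordinates, giving continuum many witnesses.\<close>
      then obtain j where j: "\<And>r. e (j r) = (D, k, r)" by metis
      have "inj (\<lambda>r. fst (X (j r)))"
      proof (rule injI)
        fix r s assume "fst (X (j r)) = fst (X (j s))"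
        then have "j r = j s" using uniq by blast
        then show "r = s" using j by (metis prod.inject)
      qed
      moreover have "fst (X (j r)) \<in> {x. f x = k \<and> (\<exists>y. (x, y) \<in> biunique_part D \<and> f y = k)}" for r
      proof -
        have "E (j r) = D" "c (j r) = k" unfolding E_def c_def by (simp_all add: j)
        then show ?thesis using f X[of "j r"] by (auto intro!: exI[of _ "snd (X (j r))"])
      qed
      ultimately show "|UNIV :: real set| \<le>o |{x. f x = k \<and> (\<exists>y. (x, y) \<in> biunique_part D \<and> f y = k)}|"
        by (rule card_of_ordLeqI)
    qed
  qed
qed

lemma nonhomeomorphic_bernstein_partition:
  fixes K :: "real set"
  assumes K: "a \<in> K" "b \<in> K" "a \<noteq> b"
  obtains P where "partition_on UNIV P" "|P| =o |K|" "\<And>B. B \<in> P \<Longrightarrow> bernstein B"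
    "\<And>A B. A \<in> P \<Longrightarrow> B \<in> P \<Longrightarrow> A \<noteq> B \<Longrightarrow> \<not> A homeomorphic B"
proof -
  have ne: "K \<noteq> {}" using K(1) by blast
  obtain f :: "real \<Rightarrow> real" where rng: "range f \<subseteq> K"
    and f: "\<And>E k. closed E \<Longrightarrow> |UNIV :: real set| \<le>o |biunique_part E| \<Longrightarrow> k \<in> K
      \<Longrightarrow> |UNIV :: real set| \<le>o |{x. f x = k \<and> (\<exists>y. (x, y) \<in> biunique_part E \<and> f y = k)}|"
    by (rule colouring_of_biunique_parts[OF ne]) (rule that)
  have ex: "\<exists>x y. (x, y) \<in> biunique_part E \<and> f x = k \<and> f y = k"
    if "closed E" "|UNIV :: real set| \<le>o |biunique_part E|" "k \<in> K" for E k
  proof -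
    have "{x. f x = k \<and> (\<exists>y. (x, y) \<in> biunique_part E \<and> f y = k)} \<noteq> {}"
      using f[OF that] card_of_empty3 by (metis UNIV_not_empty)
    then show ?thesis by blast
  qed
  have fibre: "|UNIV :: real set| \<le>o |{x \<in> F. f x = k}|"
    if F: "closed F" "uncountable F" "k \<in> K" for F k
  proof -
    \<comment> \<open>On the part of the diagonal over \<open>F\<close> every point is biunique, and
      a point with both coordinates of colour \<open>k\<close> is just a point of \<open>F\<close>
      of colour \<open>k\<close>.\<close>
    define E where "E = {p. fst p = snd p} \<inter> F \<times> F"
    have E: "biunique_part E = (\<lambda>x. (x, x)) ` F"
      unfolding E_def biunique_part_def by auto
    have "closed E"
      unfolding E_def by (intro closed_Int closed_Times closed_Collect_eq F continuous_intros)
    moreover have "|F| \<le>o |biunique_part E|"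
      unfolding E by (rule card_of_ordLeqI[of "\<lambda>x. (x, x)"]) (auto simp: inj_on_def)
    then have "|UNIV :: real set| \<le>o |biunique_part E|"
      by (rule ordLeq_transitive[OF card_of_closed_uncountable[OF F(1,2)]])
    ultimately have "|UNIV :: real set| \<le>o |{x. f x = k \<and> (\<exists>y. (x, y) \<in> biunique_part E \<and> f y = k)}|"
      using f F(3) by blast
    also have "{x. f x = k \<and> (\<exists>y. (x, y) \<in> biunique_part E \<and> f y = k)} = {x \<in> F. f x = k}"
      unfolding E by auto
    finally show ?thesis .
  qed
  have hit: "\<exists>x\<in>F. f x = k" if "closed F" "uncountable F" "k \<in> K" for F k
  proof -
    have "{x \<in> F. f x = k} \<noteq> {}"
      using fibre[OF that] card_of_empty3 by (metis UNIV_not_empty)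
    then show ?thesis by blast
  qed
  define P where "P = (\<lambda>k. f -` {k}) ` K"
  note fib = bernstein_fibres[OF rng K hit, folded P_def]
  have nonhom: "\<not> A homeomorphic B" if AB: "A \<in> P" "B \<in> P" "A \<noteq> B" for A B
  proof
    assume "A homeomorphic B"
    then obtain h g where hom: "homeomorphism A B h g" unfolding homeomorphic_def by blast
    obtain k l where kl: "k \<in> K" "A = f -` {k}" "B = f -` {l}" "k \<noteq> l"
      using AB unfolding P_def by blast
    \<comment> \<open>\<open>A\<close> has continuum many points, so \<open>E\<close> is among the
      sets handled by the colouring and has a biunique point \<open>(x, y)\<close> with both
      coordinates of colour \<open>k\<close>. Then \<open>x\<close> lies in \<open>A\<close>, so
      \<open>y = h x\<close> lies in \<open>B\<close> and has colour \<open>l\<close>, a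
      contradiction.\<close>
    define E where "E = closure ((\<lambda>x. (x, h x)) ` A)"
    have graph: "(x, h x) \<in> biunique_part E" if "x \<in> A" for x
      unfolding E_def using closure_homeomorphism_graph[OF hom that] .
    have "|UNIV :: real set| \<le>o |A|"
      using fibre[of UNIV k] uncountable_UNIV_real kl by (simp add: vimage_def)
    also have "|A| \<le>o |biunique_part E|"
      by (rule card_of_ordLeqI[of "\<lambda>x. (x, h x)"]) (auto simp: inj_on_def graph)
    finally obtain x y where xy: "(x, y) \<in> biunique_part E" "f x = k" "f y = k"
      using ex[of E k] kl(1) unfolding E_def by blast
    then have "x \<in> A" using kl by simp
    then have "y = h x" using graph biunique_partD(1,2) xy(1) by metis
    then have "y \<in> B" using hom \<open>x \<in> A\<close> unfolding homeomorphism_def by blast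
    then show False using kl xy by simp
  qed
  show ?thesis by (rule that[OF fib nonhom])
qed

section \<open>Passage to an arbitrary cardinal\<close>

theorem theorem3:
  fixes \<kappa> :: "'k rel"
  assumes "Card_order \<kappa>" and "ctwo \<le>o \<kappa>" and "\<kappa> \<le>o |UNIV :: real set|"
  shows "(\<exists>P :: real set set. partition_on UNIV P \<and> |P| =o \<kappa> \<and>
            (\<forall>B\<in>P. bernstein B) \<and> (\<forall>A\<in>P. \<forall>B\<in>P. A homeomorphic B)) \<and>
         (\<exists>P :: real set set. partition_on UNIV P \<and> |P| =o \<kappa> \<and>
            (\<forall>B\<in>P. bernstein B) \<and> (\<forall>A\<in>P. \<forall>B\<in>P. A \<noteq> B \<longrightarrow> \<not> A homeomorphic B))"
proof -
  have Field: "|Field \<kappa>| =o \<kappa>" using assms(1) by (rule card_of_Field_ordIso)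
  have "|Field \<kappa>| \<le>o |UNIV :: real set|" using Field assms(3) by (rule ordIso_ordLeq_trans)
  \<comment> \<open>The cardinal lives on an arbitrary type; a set of reals of the same size serves
    as the set of colours, and the bound by \<open>ctwo\<close> provides two distinct
    colours.\<close>
  then obtain K :: "real set" where "|Field \<kappa>| =o |K|"
    using internalize_card_of_ordLeq2[of "Field \<kappa>" "UNIV :: real set"] by blast
  then have K: "|K| =o \<kappa>" using Field by (metis ordIso_symmetric ordIso_transitive)
  have "|UNIV :: bool set| \<le>o |K|"
    using assms(2) ordIso_symmetric[OF K] unfolding ctwo_def by (rule ordLeq_ordIso_trans)
  then obtain i :: "bool \<Rightarrow> real" where "inj i" "range i \<subseteq> K"
    unfolding card_of_ordLeq[symmetric] by blast
  then have ab: "i True \<in> K" "i False \<in> K" "i True \<noteq> i False"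
    by (auto simp: inj_def)
  show ?thesis
    using homeomorphic_bernstein_partition[OF ab] nonhomeomorphic_bernstein_partition[OF ab]
      ordIso_transitive[OF _ K] by metis
qed

end
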